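(* For any set of formulae $F\subseteq\Phi$ and any formula $\phi\in\Phi$, if $F\nvdash\phi$, then there exist a trustworthiness model, a world $w$ of that model and a dataset $U\subseteq V$ such that $w,U\Vdash f$ for each formula $f\in F$ and $w,U\nVdash\phi$.
   Context: Fix a set $V$ of data variables and a set of atomic propositions. A dataset is a subset of $V$. The language $\Phi$ is generated by $\phi::=p\mid\neg\phi\mid\phi\to\phi\mid{\sf B}^T_X\phi\mid[X]\phi$, where $p$ is an atomic proposition and $X,T\subseteq V$. A trustworthiness model is a tuple $(W,\{\sim_x\}_{x\in V},\{\mathcal{T}_w\}_{w\in W},\pi)$ where $W$ is a (possibly empty) set of worlds, each $\sim_x$ is an equivalence relation on $W$, $\mathcal{T}_w\subseteq V$ for each $w\in W$, and $\pi(p)\subseteq W\times\mathcal{P}(V)$ for each atomic proposition $p$. Write $w\sim_X u$ if $w\sim_x u$ for every $x\in X$. Satisfaction $w,U\Vdash\phi$ (for $w\in W$, $U\subseteq V$): $w,U\Vdash p$ iff $(w,U)\in\pi(p)$; $w,U\Vdash\neg\phi$ iff $w,U\nVdash\phi$; $w,U\Vdash\phi\to\psi$ iff $w,U\nVdash\phi$ or $w,U\Vdash\psi$; $w,U\Vdash{\sf B}^T_X\phi$ iff $w',U\Vdash\phi$ for every $w'\in W$ with $w\sim_{X\cup U}w'$ and $T\subseteq\mathcal{T}_{w'}$; $w,U\Vdash[X]\phi$ iff $w,U\cup X\Vdash\phi$. The axioms are all propositional tautologies in $\Phi$ and all instances (for arbitrary datasets $X,Y,T,T',X'$ and formulae $\phi,\psi$)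 of: Truth ${\sf B}^\varnothing_X\phi\to\phi$; Distributivity ${\sf B}^T_X(\phi\to\psi)\to({\sf B}^T_X\phi\to{\sf B}^T_X\psi)$ and $[X](\phi\to\psi)\to([X]\phi\to[X]\psi)$; Negative Introspection $\neg{\sf B}^T_X\phi\to{\sf B}^\varnothing_X\neg{\sf B}^T_X\phi$; Monotonicity ${\sf B}^T_X\phi\to{\sf B}^{T'}_{X'}\phi$ for $T\subseteq T'$, $X\subseteq X'$; Trust ${\sf B}^T_X({\sf B}^T_Y\phi\to\phi)$; Combination $[X][Y]\phi\leftrightarrow[X\cup Y]\phi$; Commutativity $[Y]{\sf B}^T_X\phi\leftrightarrow{\sf B}^T_{Y\cup X}[Y]\phi$; Duality $\neg[X]\phi\leftrightarrow[X]\neg\phi$; Empty Announcement $[\varnothing]\phi\leftrightarrow\phi$. Inference rules: Modus Ponens, and Necessitation (from $\phi$ infer ${\sf B}^T_X\phi$; from $\phi$ infer $[X]\phi$). A theorem is a formula derivable from the axioms by these rules. $F\vdash\phi$ means $\phi$ is derivable from the theorems together with the formulae in $F$ using Modus Ponens only. *)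

theory Defs
  imports Main
begin

text \<open>The set \<open>V\<close> of data variables is a parameter of type \<^typ>\<open>'v set\<close>, so that it may be an
  arbitrary (in particular an empty) set. The type below has the formulae over all datasets of
  type \<^typ>\<open>'v set\<close>; the language over \<open>V\<close> is the set \<open>language V\<close>.\<close>

datatype ('v, 'p) form =
    Atom 'p
  | Neg "('v, 'p) form"
  | Imp "('v, 'p) form" "('v, 'p) form"  (infixr "\<rightarrow>\<^sub>f" 60)
  | Bel "'v set" "'v set" "('v, 'p) form"  \<comment> \<open>\<open>Bel T X \<phi>\<close>: trusted set \<open>T\<close> first, then \<open>X\<close>\<close>
  | Ann "'v set" "('v, 'p) form"

inductive_set language :: "'v set \<Rightarrow> ('v, 'p) form set" for V :: "'v set" where
  "Atom p \<in> language V"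
| "\<phi> \<in> language V \<Longrightarrow> Neg \<phi> \<in> language V"
| "\<phi> \<in> language V \<Longrightarrow> \<psi> \<in> language V \<Longrightarrow> (\<phi> \<rightarrow>\<^sub>f \<psi>) \<in> language V"
| "T \<subseteq> V \<Longrightarrow> X \<subseteq> V \<Longrightarrow> \<phi> \<in> language V \<Longrightarrow> Bel T X \<phi> \<in> language V"
| "X \<subseteq> V \<Longrightarrow> \<phi> \<in> language V \<Longrightarrow> Ann X \<phi> \<in> language V"

abbreviation Iff :: "('v, 'p) form \<Rightarrow> ('v, 'p) form \<Rightarrow> ('v, 'p) form"  (infixr "\<leftrightarrow>\<^sub>f" 55) where
  "\<phi> \<leftrightarrow>\<^sub>f \<psi> \<equiv> Neg ((\<phi> \<rightarrow>\<^sub>f \<psi>) \<rightarrow>\<^sub>f Neg (\<psi> \<rightarrow>\<^sub>f \<phi>))"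


text \<open>\<open>indist M x\<close> is the indistinguishability relation of \<open>x\<close>, \<open>trust M w\<close> is the set of variables
  that are trustworthy in \<open>w\<close>, and \<open>val M\<close> is the valuation. The values of \<open>indist M\<close> outside \<open>V\<close>
  and of \<open>trust M\<close> outside \<open>worlds M\<close> are irrelevant.\<close>

record ('w, 'v, 'p) tmodel =
  worlds :: "'w set"
  indist :: "'v \<Rightarrow> ('w \<times> 'w) set"
  trust :: "'w \<Rightarrow> 'v set"
  val :: "'p \<Rightarrow> ('w \<times> 'v set) set"

definition trustworthiness_model :: "'v set \<Rightarrow> ('w, 'v, 'p) tmodel \<Rightarrow> bool" where
  "trustworthiness_model V M \<longleftrightarrow>
     (\<forall>x\<in>V. equiv (worlds M) (indist M x)) \<and>
     (\<forall>w\<in>worlds M. trust M w \<subseteq> V) \<and>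
     (\<forall>p. val M p \<subseteq> worlds M \<times> Pow V)"

definition indist_on :: "('w, 'v, 'p) tmodel \<Rightarrow> 'v set \<Rightarrow> 'w \<Rightarrow> 'w \<Rightarrow> bool" where
  "indist_on M X w u \<longleftrightarrow> (\<forall>x\<in>X. (w, u) \<in> indist M x)"

primrec sat :: "('w, 'v, 'p) tmodel \<Rightarrow> 'w \<Rightarrow> 'v set \<Rightarrow> ('v, 'p) form \<Rightarrow> bool" where
  "sat M w U (Atom p) \<longleftrightarrow> (w, U) \<in> val M p"
| "sat M w U (Neg \<phi>) \<longleftrightarrow> \<not> sat M w U \<phi>"
| "sat M w U (\<phi> \<rightarrow>\<^sub>f \<psi>) \<longleftrightarrow> \<not> sat M w U \<phi> \<or> sat M w U \<psi>"
| "sat M w U (Bel T X \<phi>) \<longleftrightarrow>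
     (\<forall>w'\<in>worlds M. indist_on M (X \<union> U) w w' \<and> T \<subseteq> trust M w' \<longrightarrow> sat M w' U \<phi>)"
| "sat M w U (Ann X \<phi>) \<longleftrightarrow> sat M w (U \<union> X) \<phi>"


text \<open>For propositional tautologies, atoms and formulae \<^term>\<open>Bel T X \<phi>\<close>, \<^term>\<open>Ann X \<phi>\<close> count as
  propositional letters, whose truth values are given by \<open>v\<close>.\<close>

primrec prop_eval :: "(('v, 'p) form \<Rightarrow> bool) \<Rightarrow> ('v, 'p) form \<Rightarrow> bool" where
  "prop_eval v (Atom p) \<longleftrightarrow> v (Atom p)"
| "prop_eval v (Neg \<phi>) \<longleftrightarrow> \<not> prop_eval v \<phi>"
| "prop_eval v (\<phi> \<rightarrow>\<^sub>f \<psi>) \<longleftrightarrow> (prop_eval v \<phi> \<longrightarrow> prop_eval v \<psi>)"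
| "prop_eval v (Bel T X \<phi>) \<longleftrightarrow> v (Bel T X \<phi>)"
| "prop_eval v (Ann X \<phi>) \<longleftrightarrow> v (Ann X \<phi>)"

definition tautology :: "('v, 'p) form \<Rightarrow> bool" where
  "tautology \<phi> \<longleftrightarrow> (\<forall>v. prop_eval v \<phi>)"

text \<open>The schemata range over all datasets of type \<^typ>\<open>'v set\<close>. An instance belongs to
  \<open>language V\<close> iff all its datasets are subsets of \<open>V\<close> and all its subformulae are in
  \<open>language V\<close>, so membership in \<open>language V\<close> is imposed only once, in the rules of \<open>is_theorem\<close>.\<close>

inductive is_axiom :: "('v, 'p) form \<Rightarrow> bool" where
  Tautology: "tautology \<phi> \<Longrightarrow> is_axiom \<phi>"
| Truth: "is_axiom (Bel {} X \<phi> \<rightarrow>\<^sub>f \<phi>)"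
| Distributivity_Bel: "is_axiom (Bel T X (\<phi> \<rightarrow>\<^sub>f \<psi>) \<rightarrow>\<^sub>f (Bel T X \<phi> \<rightarrow>\<^sub>f Bel T X \<psi>))"
| Distributivity_Ann: "is_axiom (Ann X (\<phi> \<rightarrow>\<^sub>f \<psi>) \<rightarrow>\<^sub>f (Ann X \<phi> \<rightarrow>\<^sub>f Ann X \<psi>))"
| Negative_Introspection: "is_axiom (Neg (Bel T X \<phi>) \<rightarrow>\<^sub>f Bel {} X (Neg (Bel T X \<phi>)))"
| Monotonicity: "T \<subseteq> T' \<Longrightarrow> X \<subseteq> X' \<Longrightarrow> is_axiom (Bel T X \<phi> \<rightarrow>\<^sub>f Bel T' X' \<phi>)"
| Trust: "is_axiom (Bel T X (Bel T Y \<phi> \<rightarrow>\<^sub>f \<phi>))"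
| Combination: "is_axiom (Ann X (Ann Y \<phi>) \<leftrightarrow>\<^sub>f Ann (X \<union> Y) \<phi>)"
| Commutativity: "is_axiom (Ann Y (Bel T X \<phi>) \<leftrightarrow>\<^sub>f Bel T (Y \<union> X) (Ann Y \<phi>))"
| Duality: "is_axiom (Neg (Ann X \<phi>) \<leftrightarrow>\<^sub>f Ann X (Neg \<phi>))"
| Empty_Announcement: "is_axiom (Ann {} \<phi> \<leftrightarrow>\<^sub>f \<phi>)"

inductive is_theorem :: "'v set \<Rightarrow> ('v, 'p) form \<Rightarrow> bool" for V :: "'v set" where
  Axiom: "is_axiom \<phi> \<Longrightarrow> \<phi> \<in> language V \<Longrightarrow> is_theorem V \<phi>"
| Modus_Ponens: "is_theorem V (\<phi> \<rightarrow>\<^sub>f \<psi>) \<Longrightarrow> is_theorem V \<phi> \<Longrightarrow> is_theorem V \<psi>"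
| Necessitation_Bel: "is_theorem V \<phi> \<Longrightarrow> T \<subseteq> V \<Longrightarrow> X \<subseteq> V \<Longrightarrow> is_theorem V (Bel T X \<phi>)"
| Necessitation_Ann: "is_theorem V \<phi> \<Longrightarrow> X \<subseteq> V \<Longrightarrow> is_theorem V (Ann X \<phi>)"

inductive derivable :: "'v set \<Rightarrow> ('v, 'p) form set \<Rightarrow> ('v, 'p) form \<Rightarrow> bool"
  for V :: "'v set" and F :: "('v, 'p) form set" where
  Theorem: "is_theorem V \<phi> \<Longrightarrow> derivable V F \<phi>"
| Hypothesis: "\<phi> \<in> F \<Longrightarrow> derivable V F \<phi>"
| Modus_Ponens: "derivable V F (\<phi> \<rightarrow>\<^sub>f \<psi>) \<Longrightarrow> derivable V F \<phi> \<Longrightarrow> derivable V F \<psi>"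


text \<open>HOL cannot quantify existentially over the type of worlds, so the existence of a model is
  stated for models whose worlds are elements of one fixed type. It depends only on the types of
  data variables and of atomic propositions and is large enough for any language over them: its
  elements can encode finite paths whose nodes are sets of formulae and whose edges are labelled
  with pairs of datasets. The set of worlds may be any subset of it.\<close>

type_synonym ('v, 'p) world = "(('v, 'p) form set \<times> 'v set \<times> 'v set) list"

end

theory Submission
  imports Defs "HOL-Library.Sublist"
begin

text \<open>Worlds are the nodes of a tree of maximal consistent sets, grown from one that separates
  \<open>F\<close> from \<open>\<phi>\<close>. An edge labelled \<open>(T, X)\<close> leads from \<open>\<Gamma>\<close> to some \<open>\<Delta>\<close> that contains every \<open>\<psi>\<close> with
  \<open>Bel T X \<psi> \<in> \<Gamma>\<close>, and the world at its end trusts exactly \<open>T\<close>. Two worlds are indistinguishable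
  by \<open>x\<close> if \<open>x\<close> belongs to the dataset of each edge on the simple path between them. Introspection
  keeps \<open>Bel T X \<psi>\<close> constant along edges whose dataset contains \<open>X\<close>, and the Trust axiom yields
  \<open>\<psi>\<close> from \<open>Bel T X \<psi>\<close> at the end of each edge with trusted set containing \<open>T\<close>. The announced
  dataset is absorbed by proving that \<open>sat M w U \<psi>\<close> holds iff \<open>Ann U \<psi>\<close> is in the set at \<open>w\<close>.\<close>

section \<open>Derivability and maximal consistent sets\<close>

lemma language_simps [simp]:
  "Atom p \<in> language V"
  "Neg \<phi> \<in> language V \<longleftrightarrow> \<phi> \<in> language V"
  "(\<phi> \<rightarrow>\<^sub>f \<psi>) \<in> language V \<longleftrightarrow> \<phi> \<in> language V \<and> \<psi> \<in> language V"
  "Bel T X \<phi> \<in> language V \<longleftrightarrow> T \<subseteq> V \<and> X \<subseteq> V \<and> \<phi> \<in> language V"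
  "Ann X \<phi> \<in> language V \<longleftrightarrow> X \<subseteq> V \<and> \<phi> \<in> language V"
  by (auto intro: language.intros elim: language.cases)

lemma is_theorem_language: "is_theorem V \<phi> \<Longrightarrow> \<phi> \<in> language V"
  by (induction rule: is_theorem.induct) auto

lemma is_theorem_tautology: "tautology \<phi> \<Longrightarrow> \<phi> \<in> language V \<Longrightarrow> is_theorem V \<phi>"
  by (intro is_theorem.Axiom is_axiom.Tautology)

lemma derivable_language: "derivable V F \<phi> \<Longrightarrow> F \<subseteq> language V \<Longrightarrow> \<phi> \<in> language V"
  by (induction rule: derivable.induct) (auto dest: is_theorem_language)

lemma derivable_tautology: "tautology \<phi> \<Longrightarrow> \<phi> \<in> language V \<Longrightarrow> derivable V F \<phi>"
  by (intro derivable.Theorem is_theorem_tautology)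

lemma derivable_mono: "derivable V F \<phi> \<Longrightarrow> F \<subseteq> G \<Longrightarrow> derivable V G \<phi>"
  by (induction rule: derivable.induct) (auto intro: derivable.intros)

lemma derivable_Imp_intro:
  assumes "derivable V F \<phi>" "F \<subseteq> language V" "\<psi> \<in> language V"
  shows "derivable V F (\<psi> \<rightarrow>\<^sub>f \<phi>)"
proof -
  have "derivable V F (\<phi> \<rightarrow>\<^sub>f (\<psi> \<rightarrow>\<^sub>f \<phi>))"
    using assms derivable_language[OF assms(1,2)]
    by (intro derivable_tautology) (auto simp: tautology_def)
  then show ?thesis
    using assms(1) derivable.Modus_Ponens by blast
qed

text \<open>Necessitation is confined to \<open>is_theorem\<close>, and a derivation from hypotheses
  uses Modus Ponens only. So the deduction theorem holds without side conditions on the rules, by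
  the usual propositional tautologies.\<close>

lemma deduction:
  assumes "derivable V (insert \<psi> F) \<phi>" "F \<subseteq> language V" "\<psi> \<in> language V"
  shows "derivable V F (\<psi> \<rightarrow>\<^sub>f \<phi>)"
  using assms(1)
proof (induction rule: derivable.induct)
  case (Theorem \<phi>)
  then show ?case
    using assms by (intro derivable_Imp_intro derivable.Theorem)
next
  case (Hypothesis \<phi>)
  show ?case
  proof (cases "\<phi> = \<psi>")
    case True
    then show ?thesis
      using assms by (auto intro!: derivable_tautology simp: tautology_def)
  next
    case False
    then show ?thesis
      using Hypothesis assms by (auto intro: derivable_Imp_intro derivable.Hypothesis)
  qed
next
  case (Modus_Ponens \<phi> \<chi>)
  have "(\<phi> \<rightarrow>\<^sub>f \<chi>) \<in> language V"
    using derivable_language[OF Modus_Ponens.hyps(1)] assms by simp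
  then have "derivable V F ((\<psi> \<rightarrow>\<^sub>f (\<phi> \<rightarrow>\<^sub>f \<chi>)) \<rightarrow>\<^sub>f ((\<psi> \<rightarrow>\<^sub>f \<phi>) \<rightarrow>\<^sub>f (\<psi> \<rightarrow>\<^sub>f \<chi>)))"
    using assms by (intro derivable_tautology) (auto simp: tautology_def)
  then show ?case
    using Modus_Ponens.IH derivable.Modus_Ponens by blast
qed

text \<open>This replaces the finiteness of derivations: at a Modus Ponens, the members of the chain
  that derive the two premises are comparable, and the larger one derives both. A derivation without
  hypotheses still needs some member, hence \<open>C \<noteq> {}\<close>.\<close>

lemma derivable_Union_chain:
  assumes "derivable V (\<Union>C) \<phi>" "subset.chain A C" "C \<noteq> {}"
  shows "\<exists>F\<in>C. derivable V F \<phi>"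
  using assms(1)
proof (induction rule: derivable.induct)
  case (Theorem \<phi>)
  then show ?case
    using assms(3) by (auto intro: derivable.Theorem)
next
  case (Hypothesis \<phi>)
  then show ?case
    by (auto intro: derivable.Hypothesis)
next
  case (Modus_Ponens \<phi> \<psi>)
  then obtain F G where FG: "F \<in> C" "G \<in> C" "derivable V F (\<phi> \<rightarrow>\<^sub>f \<psi>)" "derivable V G \<phi>"
    by blast
  moreover have "F \<subseteq> G \<or> G \<subseteq> F"
    using assms(2) FG(1,2) by (meson subset_chain_def)
  ultimately show ?case
    using derivable_mono derivable.Modus_Ponens by metis
qed

text \<open>Consistency and maximality are the two directions of the last clause.\<close>

definition maximal_consistent :: "'v set \<Rightarrow> ('v, 'p) form set \<Rightarrow> bool" where
  "maximal_consistent V \<Gamma> \<longleftrightarrow>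
     \<Gamma> \<subseteq> language V \<and> (\<forall>\<phi>. derivable V \<Gamma> \<phi> \<longrightarrow> \<phi> \<in> \<Gamma>) \<and>
     (\<forall>\<phi>\<in>language V. Neg \<phi> \<in> \<Gamma> \<longleftrightarrow> \<phi> \<notin> \<Gamma>)"

text \<open>Zorn's lemma is applied to the extensions of \<open>F\<close> that do not derive
  \<open>\<chi>\<close>, not to all consistent ones. By maximality each formula outside
  \<open>\<Gamma>\<close> implies \<open>\<chi>\<close> over \<open>\<Gamma>\<close>; closure under
  derivation and the clause for \<open>Neg\<close> then follow by propositional reasoning.\<close>

lemma Lindenbaum:
  assumes "F \<subseteq> language V" "\<chi> \<in> language V" "\<not> derivable V F \<chi>"
  obtains \<Gamma> where "maximal_consistent V \<Gamma>" "F \<subseteq> \<Gamma>" "\<chi> \<notin> \<Gamma>"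
proof -
  define A where "A = {\<Gamma>. F \<subseteq> \<Gamma> \<and> \<Gamma> \<subseteq> language V \<and> \<not> derivable V \<Gamma> \<chi>}"
  have "F \<in> A"
    using assms by (auto simp: A_def)
  moreover have "\<Union>C \<in> A" if "C \<noteq> {}" "subset.chain A C" for C
  proof -
    have "C \<subseteq> A"
      using that(2) by (simp add: subset_chain_def)
    then show ?thesis
      using that derivable_Union_chain[of V C \<chi> A] unfolding A_def by blast
  qed
  ultimately obtain \<Gamma> where "\<Gamma> \<in> A" and max: "\<And>\<Delta>. \<Delta> \<in> A \<Longrightarrow> \<Gamma> \<subseteq> \<Delta> \<Longrightarrow> \<Delta> = \<Gamma>"
    using subset_Zorn_nonempty[of A] by blast
  then have \<Gamma>: "F \<subseteq> \<Gamma>" "\<Gamma> \<subseteq> language V" "\<not> derivable V \<Gamma> \<chi>"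
    by (auto simp: A_def)
  have inconsistent: "derivable V \<Gamma> (\<psi> \<rightarrow>\<^sub>f \<chi>)" if "\<psi> \<in> language V" "\<psi> \<notin> \<Gamma>" for \<psi>
  proof -
    have "insert \<psi> \<Gamma> \<notin> A"
      using max[of "insert \<psi> \<Gamma>"] that(2) by blast
    then have "derivable V (insert \<psi> \<Gamma>) \<chi>"
      using \<Gamma> that(1) by (auto simp: A_def)
    then show ?thesis
      using \<Gamma>(2) that(1) by (rule deduction)
  qed
  have closed: "\<psi> \<in> \<Gamma>" if "derivable V \<Gamma> \<psi>" for \<psi>
    using inconsistent[of \<psi>] derivable_language[OF that \<Gamma>(2)] that \<Gamma>(3) derivable.Modus_Ponens by blast
  have "Neg \<psi> \<in> \<Gamma> \<longleftrightarrow> \<psi> \<notin> \<Gamma>" if \<psi>: "\<psi> \<in> language V" for \<psi>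
  proof
    assume "Neg \<psi> \<in> \<Gamma>"
    moreover have "derivable V \<Gamma> (Neg \<psi> \<rightarrow>\<^sub>f (\<psi> \<rightarrow>\<^sub>f \<chi>))"
      using \<psi> assms(2) by (intro derivable_tautology) (auto simp: tautology_def)
    ultimately show "\<psi> \<notin> \<Gamma>"
      using \<Gamma>(3) by (meson derivable.Hypothesis derivable.Modus_Ponens)
  next
    assume "\<psi> \<notin> \<Gamma>"
    show "Neg \<psi> \<in> \<Gamma>"
    proof (rule ccontr)
      assume "Neg \<psi> \<notin> \<Gamma>"
      then have "derivable V \<Gamma> (Neg \<psi> \<rightarrow>\<^sub>f \<chi>)" "derivable V \<Gamma> (\<psi> \<rightarrow>\<^sub>f \<chi>)"
        using inconsistent \<psi> \<open>\<psi> \<notin> \<Gamma>\<close> by simp_all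
      moreover have "derivable V \<Gamma> ((Neg \<psi> \<rightarrow>\<^sub>f \<chi>) \<rightarrow>\<^sub>f ((\<psi> \<rightarrow>\<^sub>f \<chi>) \<rightarrow>\<^sub>f \<chi>))"
        using \<psi> assms(2) by (intro derivable_tautology) (auto simp: tautology_def)
      ultimately show False
        using \<Gamma>(3) derivable.Modus_Ponens by blast
    qed
  qed
  then have "maximal_consistent V \<Gamma>"
    using \<Gamma>(2) closed by (auto simp: maximal_consistent_def)
  moreover have "\<chi> \<notin> \<Gamma>"
    using \<Gamma>(3) derivable.Hypothesis by blast
  ultimately show ?thesis
    using that \<Gamma>(1) by blast
qed

section \<open>The axioms inside a maximal consistent set\<close>

context
  fixes V :: "'v set" and \<Gamma> :: "('v, 'p) form set"
  assumes mcs: "maximal_consistent V \<Gamma>"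
begin

lemma mcs_language: "\<phi> \<in> \<Gamma> \<Longrightarrow> \<phi> \<in> language V"
  using mcs by (auto simp: maximal_consistent_def)

lemma mcs_theorem: "is_theorem V \<phi> \<Longrightarrow> \<phi> \<in> \<Gamma>"
  using mcs by (auto simp: maximal_consistent_def intro: derivable.Theorem)

lemma mcs_axiom: "is_axiom \<phi> \<Longrightarrow> \<phi> \<in> language V \<Longrightarrow> \<phi> \<in> \<Gamma>"
  by (intro mcs_theorem is_theorem.Axiom)

lemma mcs_mp: "(\<phi> \<rightarrow>\<^sub>f \<psi>) \<in> \<Gamma> \<Longrightarrow> \<phi> \<in> \<Gamma> \<Longrightarrow> \<psi> \<in> \<Gamma>"
  using mcs unfolding maximal_consistent_def
  by (meson derivable.Hypothesis derivable.Modus_Ponens)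

lemma mcs_Neg: "\<phi> \<in> language V \<Longrightarrow> Neg \<phi> \<in> \<Gamma> \<longleftrightarrow> \<phi> \<notin> \<Gamma>"
  using mcs by (auto simp: maximal_consistent_def)

lemma mcs_Iff:
  assumes "(\<phi> \<leftrightarrow>\<^sub>f \<psi>) \<in> \<Gamma>"
  shows "\<phi> \<in> \<Gamma> \<longleftrightarrow> \<psi> \<in> \<Gamma>"
proof -
  have "((\<phi> \<leftrightarrow>\<^sub>f \<psi>) \<rightarrow>\<^sub>f (\<phi> \<rightarrow>\<^sub>f \<psi>)) \<in> \<Gamma>" "((\<phi> \<leftrightarrow>\<^sub>f \<psi>) \<rightarrow>\<^sub>f (\<psi> \<rightarrow>\<^sub>f \<phi>)) \<in> \<Gamma>"
    using mcs_language[OF assms] by (auto intro!: mcs_axiom is_axiom.Tautology simp: tautology_def)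
  then show ?thesis
    using assms mcs_mp by blast
qed

lemma mcs_Bel_mp:
  assumes "Bel T X (\<phi> \<rightarrow>\<^sub>f \<psi>) \<in> \<Gamma>" "Bel T X \<phi> \<in> \<Gamma>"
  shows "Bel T X \<psi> \<in> \<Gamma>"
proof -
  have "(Bel T X (\<phi> \<rightarrow>\<^sub>f \<psi>) \<rightarrow>\<^sub>f (Bel T X \<phi> \<rightarrow>\<^sub>f Bel T X \<psi>)) \<in> \<Gamma>"
    using mcs_language[OF assms(1)] by (auto intro!: mcs_axiom is_axiom.Distributivity_Bel)
  then show ?thesis
    using assms mcs_mp by blast
qed

lemma mcs_Bel_mono:
  assumes "Bel T X \<phi> \<in> \<Gamma>" "T \<subseteq> T'" "X \<subseteq> X'" "T' \<subseteq> V" "X' \<subseteq> V"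
  shows "Bel T' X' \<phi> \<in> \<Gamma>"
proof -
  have "(Bel T X \<phi> \<rightarrow>\<^sub>f Bel T' X' \<phi>) \<in> \<Gamma>"
    using assms mcs_language[OF assms(1)] by (auto intro!: mcs_axiom is_axiom.Monotonicity)
  then show ?thesis
    using assms mcs_mp by blast
qed

lemma mcs_truth:
  assumes "Bel {} X \<phi> \<in> \<Gamma>"
  shows "\<phi> \<in> \<Gamma>"
proof -
  have "(Bel {} X \<phi> \<rightarrow>\<^sub>f \<phi>) \<in> \<Gamma>"
    using mcs_language[OF assms] by (auto intro!: mcs_axiom is_axiom.Truth)
  then show ?thesis
    using assms mcs_mp by blast
qed

lemma mcs_negative_introspection:
  assumes "Bel T X \<phi> \<notin> \<Gamma>" "Bel T X \<phi> \<in> language V"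
  shows "Bel {} X (Neg (Bel T X \<phi>)) \<in> \<Gamma>"
proof -
  have "(Neg (Bel T X \<phi>) \<rightarrow>\<^sub>f Bel {} X (Neg (Bel T X \<phi>))) \<in> \<Gamma>"
    using assms(2) by (auto intro!: mcs_axiom is_axiom.Negative_Introspection)
  then show ?thesis
    using assms mcs_mp mcs_Neg by blast
qed

text \<open>By Truth, \<open>?c\<close> would refute \<open>?b\<close>, so \<open>?c\<close> is
  absent and Negative Introspection applies to \<open>?c\<close> itself. The contrapositive of
  Negative Introspection for \<open>?b\<close>, necessitated, then turns \<open>Neg ?c\<close> into
  \<open>?b\<close> under the modality.\<close>

lemma mcs_positive_introspection:
  assumes "Bel T X \<phi> \<in> \<Gamma>"
  shows "Bel {} X (Bel T X \<phi>) \<in> \<Gamma>"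
proof -
  let ?b = "Bel T X \<phi>"
  let ?c = "Bel {} X (Neg ?b)"
  have L: "?b \<in> language V" "?c \<in> language V" "X \<subseteq> V"
    using mcs_language[OF assms] by auto
  have "?c \<notin> \<Gamma>"
    using mcs_truth mcs_Neg[OF L(1)] assms by blast
  then have "Bel {} X (Neg ?c) \<in> \<Gamma>"
    using L(2) by (rule mcs_negative_introspection)
  moreover have "is_theorem V (Neg ?b \<rightarrow>\<^sub>f ?c)"
    using L by (intro is_theorem.Axiom is_axiom.Negative_Introspection) auto
  moreover have "is_theorem V ((Neg ?b \<rightarrow>\<^sub>f ?c) \<rightarrow>\<^sub>f (Neg ?c \<rightarrow>\<^sub>f ?b))"
    using L by (intro is_theorem_tautology) (auto simp: tautology_def)
  ultimately show ?thesis
    using L(3) mcs_Bel_mp mcs_theorem is_theorem.Necessitation_Bel is_theorem.Modus_Ponens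
    by (metis empty_subsetI)
qed

lemma mcs_Ann_mp:
  assumes "Ann X (\<phi> \<rightarrow>\<^sub>f \<psi>) \<in> \<Gamma>" "Ann X \<phi> \<in> \<Gamma>"
  shows "Ann X \<psi> \<in> \<Gamma>"
proof -
  have "(Ann X (\<phi> \<rightarrow>\<^sub>f \<psi>) \<rightarrow>\<^sub>f (Ann X \<phi> \<rightarrow>\<^sub>f Ann X \<psi>)) \<in> \<Gamma>"
    using mcs_language[OF assms(1)] by (auto intro!: mcs_axiom is_axiom.Distributivity_Ann)
  then show ?thesis
    using assms mcs_mp by blast
qed

lemma mcs_Ann_Neg:
  assumes "X \<subseteq> V" "\<phi> \<in> language V"
  shows "Ann X (Neg \<phi>) \<in> \<Gamma> \<longleftrightarrow> Ann X \<phi> \<notin> \<Gamma>"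
proof -
  have "(Neg (Ann X \<phi>) \<leftrightarrow>\<^sub>f Ann X (Neg \<phi>)) \<in> \<Gamma>"
    using assms by (intro mcs_axiom is_axiom.Duality) simp
  then show ?thesis
    using assms mcs_Iff mcs_Neg language_simps(5) by blast
qed

text \<open>Distributivity gives one direction. For the other, Duality turns the absence of
  \<open>Ann X \<phi>\<close> into \<open>Ann X (Neg \<phi>)\<close>, so that two necessitated
  tautologies cover both ways in which the implication can hold.\<close>

lemma mcs_Ann_Imp:
  assumes "X \<subseteq> V" "\<phi> \<in> language V" "\<psi> \<in> language V"
  shows "Ann X (\<phi> \<rightarrow>\<^sub>f \<psi>) \<in> \<Gamma> \<longleftrightarrow> (Ann X \<phi> \<in> \<Gamma> \<longrightarrow> Ann X \<psi> \<in> \<Gamma>)"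
proof -
  have "Ann X (Neg \<phi> \<rightarrow>\<^sub>f (\<phi> \<rightarrow>\<^sub>f \<psi>)) \<in> \<Gamma>" "Ann X (\<psi> \<rightarrow>\<^sub>f (\<phi> \<rightarrow>\<^sub>f \<psi>)) \<in> \<Gamma>"
    using assms
    by (intro mcs_theorem is_theorem.Necessitation_Ann is_theorem_tautology;
        simp add: tautology_def)+
  then show ?thesis
    using assms mcs_Ann_mp mcs_Ann_Neg by blast
qed

lemma mcs_Ann_Ann:
  assumes "X \<subseteq> V" "Y \<subseteq> V" "\<phi> \<in> language V"
  shows "Ann X (Ann Y \<phi>) \<in> \<Gamma> \<longleftrightarrow> Ann (X \<union> Y) \<phi> \<in> \<Gamma>"
  using assms by (intro mcs_Iff mcs_axiom is_axiom.Combination) simp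

lemma mcs_Ann_Bel:
  assumes "X \<subseteq> V" "Y \<subseteq> V" "T \<subseteq> V" "\<phi> \<in> language V"
  shows "Ann Y (Bel T X \<phi>) \<in> \<Gamma> \<longleftrightarrow> Bel T (Y \<union> X) (Ann Y \<phi>) \<in> \<Gamma>"
  using assms by (intro mcs_Iff mcs_axiom is_axiom.Commutativity) simp

lemma mcs_Ann_empty: "\<phi> \<in> language V \<Longrightarrow> Ann {} \<phi> \<in> \<Gamma> \<longleftrightarrow> \<phi> \<in> \<Gamma>"
  by (intro mcs_Iff mcs_axiom is_axiom.Empty_Announcement) simp

end

section \<open>Accessibility between maximal consistent sets\<close>

definition accessible ::
  "'v set \<Rightarrow> 'v set \<Rightarrow> ('v, 'p) form set \<Rightarrow> ('v, 'p) form set \<Rightarrow> bool" where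
  "accessible T X \<Gamma> \<Delta> \<longleftrightarrow> (\<forall>\<phi>. Bel T X \<phi> \<in> \<Gamma> \<longrightarrow> \<phi> \<in> \<Delta>)"

text \<open>Whatever follows from the contents of the beliefs in \<open>\<Gamma>\<close> is itself
  believed, by Necessitation for theorems and Distributivity for Modus Ponens. So these contents do
  not derive \<open>\<phi>\<close>, and Lindenbaum's lemma extends them.\<close>

lemma accessible_witness:
  assumes \<Gamma>: "maximal_consistent V \<Gamma>" and L: "Bel T X \<phi> \<in> language V"
    and "Bel T X \<phi> \<notin> \<Gamma>"
  obtains \<Delta> where "maximal_consistent V \<Delta>" "accessible T X \<Gamma> \<Delta>" "\<phi> \<notin> \<Delta>"
proof -
  define F where "F = {\<psi>. Bel T X \<psi> \<in> \<Gamma>}"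
  have "Bel T X \<psi> \<in> \<Gamma>" if "derivable V F \<psi>" for \<psi>
    using that
  proof (induction rule: derivable.induct)
    case (Theorem \<psi>)
    then show ?case
      using L by (auto intro: mcs_theorem[OF \<Gamma>] is_theorem.Necessitation_Bel)
  qed (auto simp: F_def intro: mcs_Bel_mp[OF \<Gamma>])
  then have "\<not> derivable V F \<phi>"
    using assms(3) by blast
  moreover have "F \<subseteq> language V"
    using mcs_language[OF \<Gamma>] by (force simp: F_def)
  ultimately obtain \<Delta> where "maximal_consistent V \<Delta>" "F \<subseteq> \<Delta>" "\<phi> \<notin> \<Delta>"
    using L Lindenbaum[of F V \<phi>] by auto
  then show ?thesis
    using that by (auto simp: F_def accessible_def)
qed

text \<open>The two introspection principles record both a belief and its absence in
  \<open>\<Gamma>\<close> under \<open>Bel {} X\<close>. Monotonicity raises this to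
  \<open>Bel T Y\<close>, which the edge carries to \<open>\<Delta>\<close>. As introspection yields
  the empty trusted set, \<open>T\<close> and \<open>T'\<close> may be unrelated.\<close>

lemma accessible_Bel_iff:
  assumes \<Gamma>: "maximal_consistent V \<Gamma>" and \<Delta>: "maximal_consistent V \<Delta>"
    and "accessible T Y \<Gamma> \<Delta>" "T \<subseteq> V" "Y \<subseteq> V" "X \<subseteq> Y"
    and L: "Bel T' X \<phi> \<in> language V"
  shows "Bel T' X \<phi> \<in> \<Gamma> \<longleftrightarrow> Bel T' X \<phi> \<in> \<Delta>"
proof -
  have transfer: "\<psi> \<in> \<Delta>" if "Bel {} X \<psi> \<in> \<Gamma>" for \<psi>
    using mcs_Bel_mono[OF \<Gamma> that, of T Y] assms by (auto simp: accessible_def)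
  show ?thesis
    using transfer mcs_positive_introspection[OF \<Gamma>] mcs_negative_introspection[OF \<Gamma> _ L]
      mcs_Neg[OF \<Delta> L] by blast
qed

text \<open>In the Trust axiom both beliefs have the same trusted set. It is taken to be the set
  \<open>T\<close> of the edge, and Monotonicity lifts the given belief from \<open>T'\<close> to
  \<open>T\<close>.\<close>

lemma accessible_trust:
  assumes \<Gamma>: "maximal_consistent V \<Gamma>" and \<Delta>: "maximal_consistent V \<Delta>"
    and "accessible T Y \<Gamma> \<Delta>" "T \<subseteq> V" "Y \<subseteq> V" "T' \<subseteq> T"
    and b: "Bel T' X \<phi> \<in> \<Delta>"
  shows "\<phi> \<in> \<Delta>"
proof -
  have L: "X \<subseteq> V" "\<phi> \<in> language V"
    using mcs_language[OF \<Delta> b] by auto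
  have "Bel T Y (Bel T X \<phi> \<rightarrow>\<^sub>f \<phi>) \<in> \<Gamma>"
    using L assms by (intro mcs_axiom[OF \<Gamma>] is_axiom.Trust) simp
  then have "(Bel T X \<phi> \<rightarrow>\<^sub>f \<phi>) \<in> \<Delta>"
    using assms by (auto simp: accessible_def)
  moreover have "Bel T X \<phi> \<in> \<Delta>"
    using mcs_Bel_mono[OF \<Delta> b] assms L by blast
  ultimately show ?thesis
    using mcs_mp[OF \<Delta>] by blast
qed

section \<open>The canonical tree\<close>

text \<open>A world lists the edges from itself back to the root \<open>[]\<close>, so that the worlds on the way to
  the root are its suffixes.\<close>

primrec label :: "('v, 'p) form set \<Rightarrow> ('v, 'p) world \<Rightarrow> ('v, 'p) form set" where
  "label \<Gamma>\<^sub>0 [] = \<Gamma>\<^sub>0"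
| "label \<Gamma>\<^sub>0 (e # w) = fst e"

primrec tree_trust :: "('v, 'p) world \<Rightarrow> 'v set" where
  "tree_trust [] = {}"
| "tree_trust (e # w) = fst (snd e)"

text \<open>Paths rather than bare maximal consistent sets serve as worlds because simple paths in a
  tree are unique: worlds indistinguishable by each variable of a dataset are then joined by a
  single path whose edges all carry the whole dataset.\<close>

inductive_set tree :: "'v set \<Rightarrow> ('v, 'p) form set \<Rightarrow> ('v, 'p) world set"
  for V :: "'v set" and \<Gamma>\<^sub>0 :: "('v, 'p) form set" where
  root: "[] \<in> tree V \<Gamma>\<^sub>0"
| edge: "w \<in> tree V \<Gamma>\<^sub>0 \<Longrightarrow> T \<subseteq> V \<Longrightarrow> X \<subseteq> V \<Longrightarrow> maximal_consistent V \<Delta> \<Longrightarrow>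
    accessible T X (label \<Gamma>\<^sub>0 w) \<Delta> \<Longrightarrow> (\<Delta>, T, X) # w \<in> tree V \<Gamma>\<^sub>0"

text \<open>The edges between two worlds are those that lie on the way to the root for exactly one of
  them; phrased like this, indistinguishability is evidently an equivalence.\<close>

definition tree_indist :: "'v set \<Rightarrow> ('v, 'p) form set \<Rightarrow> 'v \<Rightarrow> (('v, 'p) world \<times> ('v, 'p) world) set"
  where "tree_indist V \<Gamma>\<^sub>0 x = {(w, u) \<in> tree V \<Gamma>\<^sub>0 \<times> tree V \<Gamma>\<^sub>0.
    \<forall>\<Delta> T X v. suffix ((\<Delta>, T, X) # v) w \<noteq> suffix ((\<Delta>, T, X) # v) u \<longrightarrow> x \<in> X}"

text \<open>The truth of an atom may depend on the announced dataset, and no axiom reduces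
  \<open>Ann U (Atom p)\<close> for nonempty \<open>U\<close>; hence the valuation reads off this
  formula.\<close>

definition tree_model ::
  "'v set \<Rightarrow> ('v, 'p) form set \<Rightarrow> (('v, 'p) world, 'v, 'p) tmodel" where
  "tree_model V \<Gamma>\<^sub>0 =
     \<lparr>worlds = tree V \<Gamma>\<^sub>0, indist = tree_indist V \<Gamma>\<^sub>0, trust = tree_trust,
      val = \<lambda>p. {(w, U). w \<in> tree V \<Gamma>\<^sub>0 \<and> U \<subseteq> V \<and> Ann U (Atom p) \<in> label \<Gamma>\<^sub>0 w}\<rparr>"

lemma tree_trust_subset: "w \<in> tree V \<Gamma>\<^sub>0 \<Longrightarrow> tree_trust w \<subseteq> V"
  by (induction rule: tree.induct) auto

lemma equiv_tree_indist: "equiv (tree V \<Gamma>\<^sub>0) (tree_indist V \<Gamma>\<^sub>0 x)"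
proof (rule equivI)
  show "trans (tree_indist V \<Gamma>\<^sub>0 x)"
    unfolding trans_def tree_indist_def by simp metis
qed (auto simp: tree_indist_def refl_on_def sym_def)

lemma trustworthiness_tree_model: "trustworthiness_model V (tree_model V \<Gamma>\<^sub>0)"
  using equiv_tree_indist
  by (auto simp: trustworthiness_model_def tree_model_def dest: tree_trust_subset)

section \<open>Paths between worlds\<close>

definition connected_on :: "'v set \<Rightarrow> ('v, 'p) world \<Rightarrow> ('v, 'p) world \<Rightarrow> bool" where
  "connected_on Y w u \<longleftrightarrow>
    (\<forall>\<Delta> T X v. suffix ((\<Delta>, T, X) # v) w \<noteq> suffix ((\<Delta>, T, X) # v) u \<longrightarrow> Y \<subseteq> X)"

text \<open>The quantifiers over variables of \<open>Y\<close> and over edges commute, which leaves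
  one inclusion per edge.\<close>

lemma indist_on_tree_model:
  assumes "w \<in> tree V \<Gamma>\<^sub>0" "u \<in> tree V \<Gamma>\<^sub>0"
  shows "indist_on (tree_model V \<Gamma>\<^sub>0) Y w u \<longleftrightarrow> connected_on Y w u"
  using assms unfolding indist_on_def tree_model_def connected_on_def tree_indist_def
  by simp blast

lemma connected_on_sym: "connected_on Y w u \<Longrightarrow> connected_on Y u w"
  unfolding connected_on_def by metis

text \<open>An edge that is not on the way from \<open>u\<close> to the root is the first one on the
  path from its lower end to \<open>u\<close>; the rest of that path starts at the parent.\<close>

lemma connected_on_ConsD:
  assumes "connected_on Y ((\<Delta>, T, X) # w) u" "\<not> suffix ((\<Delta>, T, X) # w) u"
  shows "Y \<subseteq> X" "connected_on Y w u"
proof -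
  show "Y \<subseteq> X"
    using assms suffix_order.refl unfolding connected_on_def by blast
  show "connected_on Y w u"
    unfolding connected_on_def
  proof (intro allI impI)
    fix \<Delta>' T' X' v
    assume "suffix ((\<Delta>', T', X') # v) w \<noteq> suffix ((\<Delta>', T', X') # v) u"
    \<comment> \<open>Prepending the edge affects only the suffix that is the whole list, and that
      one is no suffix of \<open>u\<close>, so it separates the two worlds as well.\<close>
    then have "suffix ((\<Delta>', T', X') # v) ((\<Delta>, T, X) # w) \<noteq> suffix ((\<Delta>', T', X') # v) u"
      using assms(2) by (auto simp: suffix_Cons)
    then show "Y \<subseteq> X'"
      using assms(1) unfolding connected_on_def by blast
  qed
qed

lemma connected_on_parent: "connected_on X w ((\<Delta>, T, X) # w)"
  by (auto simp: connected_on_def suffix_Cons)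

section \<open>Beliefs along paths and the truth lemma\<close>

context
  fixes V :: "'v set" and \<Gamma>\<^sub>0 :: "('v, 'p) form set"
  assumes root: "maximal_consistent V \<Gamma>\<^sub>0"
begin

lemma mcs_label: "w \<in> tree V \<Gamma>\<^sub>0 \<Longrightarrow> maximal_consistent V (label \<Gamma>\<^sub>0 w)"
  by (induction rule: tree.induct) (auto simp: root)

lemma tree_ConsD:
  assumes "(\<Delta>, T, X) # w \<in> tree V \<Gamma>\<^sub>0"
  shows "w \<in> tree V \<Gamma>\<^sub>0" "T \<subseteq> V" "X \<subseteq> V" "maximal_consistent V \<Delta>" "accessible T X (label \<Gamma>\<^sub>0 w) \<Delta>"
  using assms by (auto elim: tree.cases)

lemma connected_on_Bel_parent:
  assumes "e # w \<in> tree V \<Gamma>\<^sub>0" "connected_on X (e # w) u" "\<not> suffix (e # w) u"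
    and L: "Bel T X \<phi> \<in> language V"
  shows "connected_on X w u" "Bel T X \<phi> \<in> label \<Gamma>\<^sub>0 (e # w) \<longleftrightarrow> Bel T X \<phi> \<in> label \<Gamma>\<^sub>0 w"
proof -
  obtain \<Delta> S Y where e: "e = (\<Delta>, S, Y)"
    by (cases e)
  note w = tree_ConsD[OF assms(1)[unfolded e]]
  have "X \<subseteq> Y"
    using assms(2,3) unfolding e by (rule connected_on_ConsD)
  then show "Bel T X \<phi> \<in> label \<Gamma>\<^sub>0 (e # w) \<longleftrightarrow> Bel T X \<phi> \<in> label \<Gamma>\<^sub>0 w"
    using accessible_Bel_iff[OF mcs_label[OF w(1)] w(4,5,2,3) _ L] by (simp add: e)
  show "connected_on X w u"
    using assms(2,3) unfolding e by (rule connected_on_ConsD)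
qed

lemma connected_on_Bel_suffix:
  assumes "u \<in> tree V \<Gamma>\<^sub>0" "connected_on X u w" "suffix w u" and L: "Bel T X \<phi> \<in> language V"
  shows "Bel T X \<phi> \<in> label \<Gamma>\<^sub>0 u \<longleftrightarrow> Bel T X \<phi> \<in> label \<Gamma>\<^sub>0 w"
  using assms(1-3)
proof (induction u rule: list.induct)
  case (Cons e v)
  show ?case
  proof (cases "w = e # v")
    case False
    \<comment> \<open>As \<open>w\<close> is a proper suffix, the top edge is not on its way to the
      root, so the step to the parent stays on the path to \<open>w\<close>.\<close>
    then have w: "\<not> suffix (e # v) w" "suffix w v"
      using Cons.prems(3) suffix_order.antisym[of w "e # v"] by (auto simp: suffix_Cons)
    moreover have "v \<in> tree V \<Gamma>\<^sub>0"
      using Cons.prems(1) by (cases e) (auto dest: tree_ConsD)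
    ultimately show ?thesis
      using Cons.IH connected_on_Bel_parent[OF Cons.prems(1,2) w(1) L] by blast
  qed simp
qed simp

text \<open>The path climbs from \<open>w\<close> to a common ancestor and descends to
  \<open>u\<close>. The induction performs the climb until it meets a suffix of \<open>u\<close>, at
  the latest the root; the descent is the previous lemma, read from \<open>u\<close>
  upwards.\<close>

lemma connected_on_Bel_iff:
  assumes "w \<in> tree V \<Gamma>\<^sub>0" "u \<in> tree V \<Gamma>\<^sub>0" "connected_on X w u" and L: "Bel T X \<phi> \<in> language V"
  shows "Bel T X \<phi> \<in> label \<Gamma>\<^sub>0 w \<longleftrightarrow> Bel T X \<phi> \<in> label \<Gamma>\<^sub>0 u"
  using assms(1,3)
proof (induction w rule: list.induct)
  case Nil
  then show ?case
    using connected_on_Bel_suffix[OF assms(2) connected_on_sym[OF Nil(2)] _ L] by simp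
next
  case (Cons e v)
  show ?case
  proof (cases "suffix (e # v) u")
    case True
    then show ?thesis
      using connected_on_Bel_suffix[OF assms(2) connected_on_sym[OF Cons.prems(2)] _ L] by simp
  next
    case False
    moreover have "v \<in> tree V \<Gamma>\<^sub>0"
      using Cons.prems(1) by (cases e) (auto dest: tree_ConsD)
    ultimately show ?thesis
      using Cons.IH connected_on_Bel_parent[OF Cons.prems _ L] by simp
  qed
qed

lemma tree_trusted:
  assumes "w \<in> tree V \<Gamma>\<^sub>0" "T \<subseteq> tree_trust w" "Bel T X \<phi> \<in> label \<Gamma>\<^sub>0 w"
  shows "\<phi> \<in> label \<Gamma>\<^sub>0 w"
  using assms(1)
proof cases
  case root
  then show ?thesis
    using assms mcs_truth[OF mcs_label[OF assms(1)]] by auto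
next
  case (edge v S Y \<Delta>)
  then show ?thesis
    using assms accessible_trust[OF mcs_label[OF edge(2)] edge(5,6,3,4)] by auto
qed

lemma truth_lemma:
  assumes "\<phi> \<in> language V" "w \<in> tree V \<Gamma>\<^sub>0" "U \<subseteq> V"
  shows "sat (tree_model V \<Gamma>\<^sub>0) w U \<phi> \<longleftrightarrow> Ann U \<phi> \<in> label \<Gamma>\<^sub>0 w"
  using assms
proof (induction \<phi> arbitrary: w U rule: form.induct)
  case (Atom p)
  then show ?case
    by (simp add: tree_model_def)
next
  case (Neg \<phi>)
  then show ?case
    by (simp add: mcs_Ann_Neg[OF mcs_label])
next
  case (Imp \<phi> \<psi>)
  then show ?case
    by (auto simp: mcs_Ann_Imp[OF mcs_label])
next
  case (Ann X \<phi>)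
  then show ?case
    by (simp add: mcs_Ann_Ann[OF mcs_label])
next
  case (Bel T X \<phi>)
  \<comment> \<open>This is Commutativity applied to \<open>Ann U (Bel T X \<phi>)\<close>. It
    mirrors the semantics, where announced data refine indistinguishability and stay announced
    inside the belief.\<close>
  let ?b = "Bel T (U \<union> X) (Ann U \<phi>)"
  have L: "T \<subseteq> V" "X \<subseteq> V" "\<phi> \<in> language V" "?b \<in> language V"
    using Bel.prems by auto
  have "sat (tree_model V \<Gamma>\<^sub>0) w U (Bel T X \<phi>) \<longleftrightarrow>
      (\<forall>u\<in>tree V \<Gamma>\<^sub>0. connected_on (U \<union> X) w u \<and> T \<subseteq> tree_trust u \<longrightarrow> Ann U \<phi> \<in> label \<Gamma>\<^sub>0 u)"
    using Bel.IH[OF L(3) _ Bel.prems(3)] indist_on_tree_model[OF Bel.prems(2)]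
    by (auto simp: tree_model_def Un_commute)
  also have "\<dots> \<longleftrightarrow> ?b \<in> label \<Gamma>\<^sub>0 w"
  proof
    assume "?b \<in> label \<Gamma>\<^sub>0 w"
    then show "\<forall>u\<in>tree V \<Gamma>\<^sub>0. connected_on (U \<union> X) w u \<and> T \<subseteq> tree_trust u \<longrightarrow>
        Ann U \<phi> \<in> label \<Gamma>\<^sub>0 u"
      using connected_on_Bel_iff[OF Bel.prems(2) _ _ L(4)] tree_trusted by blast
  next
    assume *: "\<forall>u\<in>tree V \<Gamma>\<^sub>0. connected_on (U \<union> X) w u \<and> T \<subseteq> tree_trust u \<longrightarrow>
        Ann U \<phi> \<in> label \<Gamma>\<^sub>0 u"
    show "?b \<in> label \<Gamma>\<^sub>0 w"
    proof (rule ccontr)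
      assume "?b \<notin> label \<Gamma>\<^sub>0 w"
      \<comment> \<open>The counterexample becomes a new child of \<open>w\<close>: its edge makes
        it trust \<open>T\<close> and keeps it indistinguishable from \<open>w\<close> by
        \<open>U \<union> X\<close>.\<close>
      then obtain \<Delta> where \<Delta>: "maximal_consistent V \<Delta>" "accessible T (U \<union> X) (label \<Gamma>\<^sub>0 w) \<Delta>"
          "Ann U \<phi> \<notin> \<Delta>"
        using accessible_witness[OF mcs_label[OF Bel.prems(2)] L(4)] by blast
      then have "(\<Delta>, T, U \<union> X) # w \<in> tree V \<Gamma>\<^sub>0"
        using Bel.prems L by (intro tree.edge) auto
      then show False
        using * \<Delta>(3) connected_on_parent[of "U \<union> X" w \<Delta> T] by fastforce
    qed
  qed
  also have "\<dots> \<longleftrightarrow> Ann U (Bel T X \<phi>) \<in> label \<Gamma>\<^sub>0 w"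
    using mcs_Ann_Bel[OF mcs_label] Bel.prems L by blast
  finally show ?case .
qed

end

theorem theorem2:
  fixes V :: "'v set" and F :: "('v, 'p) form set" and \<phi> :: "('v, 'p) form"
  assumes "F \<subseteq> language V" and "\<phi> \<in> language V"
    and "\<not> derivable V F \<phi>"
  shows "\<exists>(M :: (('v, 'p) world, 'v, 'p) tmodel) w U.
           trustworthiness_model V M \<and> w \<in> worlds M \<and> U \<subseteq> V \<and>
           (\<forall>f\<in>F. sat M w U f) \<and> \<not> sat M w U \<phi>"
proof -
  obtain \<Gamma> where \<Gamma>: "maximal_consistent V \<Gamma>" "F \<subseteq> \<Gamma>" "\<phi> \<notin> \<Gamma>"
    using Lindenbaum[OF assms] .
  let ?M = "tree_model V \<Gamma>"
  \<comment> \<open>At the root with nothing announced, Empty Announcement removes the prefix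
    \<open>Ann {}\<close> left by the truth lemma.\<close>
  have sat_root: "sat ?M [] {} \<psi> \<longleftrightarrow> \<psi> \<in> \<Gamma>" if "\<psi> \<in> language V" for \<psi>
    using truth_lemma[OF \<Gamma>(1) that tree.root] mcs_Ann_empty[OF \<Gamma>(1) that] by simp
  have "\<forall>f\<in>F. sat ?M [] {} f" "\<not> sat ?M [] {} \<phi>"
    using sat_root assms(1,2) \<Gamma>(2,3) by blast+
  moreover have "[] \<in> worlds ?M"
    by (simp add: tree_model_def tree.root)
  ultimately show ?thesis
    using trustworthiness_tree_model by blast
qed

end
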